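(* Let $\mathcal{H}$ be a real Hilbert space and $\mathcal{D}\subset\mathcal{H}$ a dictionary with $\|g\|=1$ for all $g\in\mathcal{D}$. Let $1<p<2$ and $s=\frac1p-\frac12$. There is an absolute constant $C$ such that for all $f\in\mathcal{B}_p$, the residuals $r_N=f-f_N$ of both the orthogonal greedy algorithm (OGA) and the relaxed greedy algorithm (RGA, with either of the two choices of $(\alpha_k)$ given in the context) applied to $f$ satisfy $$\|r_N\|\le C\,\|f\|_{\mathcal{B}_p}N^{-s},\qquad N=1,2,\ldots.$$ Therefore, for each of these algorithms, $\mathcal{B}_p\subset\mathcal{G}^s\subset\mathcal{A}^s$.
   Context: $\mathcal{L}_1=\mathcal{L}_1(\mathcal{D})$ is the set of $f\in\mathcal{H}$ admitting an expansion $f=\sum_{g\in\mathcal{D}}c_g g$ with $\sum_g|c_g|<\infty$, with norm $\|f\|_{\mathcal{L}_1}=\inf\{\sum_{g}|c_g| : f=\sum_{g}c_g g\}$. For $t>0$, $K(f,t)=\inf_{h\in\mathcal{L}_1}\{\|f-h\|+t\|h\|_{\mathcal{L}_1}\}$. For $1<p<2$ let $\theta=\frac2p-1\in(0,1)$. The space $\mathcal{B}_p=[\mathcal{H},\mathcal{L}_1]_{\theta,\infty}$ consists of all $f\in\mathcal{H}$ such that $K(f,t)\le Ct^\theta$ for all $t>0$ and some finite $C$; $\|f\|_{\mathcal{B}_p}$ is the smallest such $C$. OGA: $f_0=0$, $r_0=f$; for $k\ge1$ choose $g_k\in\mathcal{D}$ maximizing $|\langle r_{k-1},g\rangle|$ over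 $g\in\mathcal{D}$, let $f_k$ be the orthogonal projection of $f$ onto $\mathrm{Span}\{g_1,\dots,g_k\}$ and $r_k=f-f_k$. RGA: $f_0=0$; for $k\ge1$, $f_k=\alpha_kf_{k-1}+\beta_kg_k$, where $(\beta_k,g_k)$ minimizes $\|f-\alpha_kf_{k-1}-\beta g\|$ over $(\beta,g)\in\mathbb{R}\times\mathcal{D}$, and $r_k=f-f_k$; the sequence $(\alpha_k)$ is either $\alpha_k=1-\frac1k$ ($k\ge1$), or $\alpha_1=0$, $\alpha_k=1-\frac2k$ ($k>1$). The maximizers/minimizers in these algorithms are assumed to exist, with ties broken by an arbitrary fixed rule. $\sigma_N(f)$ is the infimum of $\|f-\hat f\|$ over all linear combinations $\hat f$ of at most $N$ elements of $\mathcal{D}$. $\mathcal{A}^s$ is the set of $f\in\mathcal{H}$ for which there is a finite $M$ with $\sigma_N(f)\le MN^{-s}$ for $N=1,2,\dots$. $\mathcal{G}^s$ is the set of $f\in\mathcal{H}$ for which there is a finite $M$ such that the greedy algorithm under consideration applied to $f$ satisfies $\|r_N\|\le MN^{-s}$ for $N=1,2,\dots$. *)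

theory Defs
  imports "HOL-Analysis.Analysis"
begin

text \<open>
  A real Hilbert space is a type of class \<open>{real_inner, complete_space}\<close>, and a dictionary is a set
  \<open>D\<close> of unit vectors in it. The span of \<open>D\<close> is not assumed to be dense; no result here depends on it.
\<close>

definition dictionary :: "'a::real_inner set \<Rightarrow> bool" where
  "dictionary D \<longleftrightarrow> (\<forall>g\<in>D. norm g = 1)"


subsection \<open>The space L1, the K-functional and the interpolation spaces\<close>

text \<open>
  \<open>D\<close> may be uncountable, so expansions are unordered sums (\<open>has_sum\<close>).
\<close>

definition L1_expansion :: "'a::real_inner set \<Rightarrow> 'a \<Rightarrow> ('a \<Rightarrow> real) \<Rightarrow> bool" where
  "L1_expansion D f c \<longleftrightarrow>
     (\<lambda>g. \<bar>c g\<bar>) summable_on D \<and> ((\<lambda>g. c g *\<^sub>R g) has_sum f) D"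

definition L1_space :: "'a::real_inner set \<Rightarrow> 'a set" where
  "L1_space D = {f. \<exists>c. L1_expansion D f c}"

definition L1_norm :: "'a::real_inner set \<Rightarrow> 'a \<Rightarrow> real" where
  "L1_norm D f = Inf {(\<Sum>\<^sub>\<infinity>g\<in>D. \<bar>c g\<bar>) |c. L1_expansion D f c}"

definition K_functional :: "'a::real_inner set \<Rightarrow> 'a \<Rightarrow> real \<Rightarrow> real" where
  "K_functional D f t = (INF h\<in>L1_space D. norm (f - h) + t * L1_norm D h)"

definition interp_space :: "'a::real_inner set \<Rightarrow> real \<Rightarrow> 'a set" where
  "interp_space D \<theta> = {f. \<exists>C. \<forall>t>0. K_functional D f t \<le> C * t powr \<theta>}"

text \<open>
  On \<open>interp_space D \<theta>\<close> the set of admissible constants is nonempty, closed and bounded below by 0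
  (since the K-functional is nonnegative), so this infimum is the smallest admissible constant.
\<close>

definition interp_norm :: "'a::real_inner set \<Rightarrow> real \<Rightarrow> 'a \<Rightarrow> real" where
  "interp_norm D \<theta> f = Inf {C. \<forall>t>0. K_functional D f t \<le> C * t powr \<theta>}"

definition B_space :: "'a::real_inner set \<Rightarrow> real \<Rightarrow> 'a set" where
  "B_space D p = interp_space D (2 / p - 1)"

definition B_norm :: "'a::real_inner set \<Rightarrow> real \<Rightarrow> 'a \<Rightarrow> real" where
  "B_norm D p f = interp_norm D (2 / p - 1) f"


subsection \<open>Greedy algorithms\<close>

definition is_orthogonal_projection :: "'a::real_inner set \<Rightarrow> 'a \<Rightarrow> 'a \<Rightarrow> bool" where
  "is_orthogonal_projection V f u \<longleftrightarrow> u \<in> V \<and> (\<forall>v\<in>V. orthogonal (f - u) v)"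

text \<open>
  The predicates below say that \<open>F 0, F 1, F 2, \<dots>\<close> is a sequence of approximants produced by the
  algorithm from input \<open>f\<close>, for some way of breaking ties. Having a run includes the existence of
  the maximizers or minimizers along it.
\<close>

definition OGA_run :: "'a::real_inner set \<Rightarrow> 'a \<Rightarrow> (nat \<Rightarrow> 'a) \<Rightarrow> bool" where
  "OGA_run D f F \<longleftrightarrow> F 0 = 0 \<and>
     (\<exists>g. \<forall>k\<ge>1. g k \<in> D
        \<and> (\<forall>h\<in>D. \<bar>(f - F (k - 1)) \<bullet> h\<bar> \<le> \<bar>(f - F (k - 1)) \<bullet> g k\<bar>)
        \<and> is_orthogonal_projection (span (g ` {1..k})) f (F k))"

definition RGA_run ::
  "(nat \<Rightarrow> real) \<Rightarrow> 'a::real_inner set \<Rightarrow> 'a \<Rightarrow> (nat \<Rightarrow> 'a) \<Rightarrow> bool" where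
  "RGA_run \<alpha> D f F \<longleftrightarrow> F 0 = 0 \<and>
     (\<exists>\<beta> g. \<forall>k\<ge>1. g k \<in> D
        \<and> (\<forall>b. \<forall>h\<in>D. norm (f - \<alpha> k *\<^sub>R F (k - 1) - \<beta> k *\<^sub>R g k)
                    \<le> norm (f - \<alpha> k *\<^sub>R F (k - 1) - b *\<^sub>R h))
        \<and> F k = \<alpha> k *\<^sub>R F (k - 1) + \<beta> k *\<^sub>R g k)"

text \<open>The two relaxation sequences; only their values at \<open>k \<ge> 1\<close> matter.\<close>

definition relax1 :: "nat \<Rightarrow> real" where
  "relax1 k = 1 - 1 / real k"

definition relax2 :: "nat \<Rightarrow> real" where
  "relax2 k = (if k = 1 then 0 else 1 - 2 / real k)"


subsection \<open>Approximation classes\<close>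

definition sparse_combinations :: "'a::real_inner set \<Rightarrow> nat \<Rightarrow> 'a set" where
  "sparse_combinations D N = (\<Union>S\<in>{S. S \<subseteq> D \<and> finite S \<and> card S \<le> N}. span S)"

definition best_error :: "'a::real_inner set \<Rightarrow> nat \<Rightarrow> 'a \<Rightarrow> real" where
  "best_error D N f = (INF h\<in>sparse_combinations D N. norm (f - h))"

definition A_class :: "'a::real_inner set \<Rightarrow> real \<Rightarrow> 'a set" where
  "A_class D s = {f. \<exists>M. \<forall>N\<ge>1. best_error D N f \<le> M * real N powr (- s)}"

text \<open>
  An algorithm with a fixed rule for breaking ties is a map \<open>G\<close> sending each input \<open>f\<close> to its
  sequence of approximants \<open>G f\<close>.
\<close>

definition G_class :: "('a::real_inner \<Rightarrow> nat \<Rightarrow> 'a) \<Rightarrow> real \<Rightarrow> 'a set" where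
  "G_class G s = {f. \<exists>M. \<forall>N\<ge>1. norm (f - G f N) \<le> M * real N powr (- s)}"

end

theory Submission imports Defs begin

text \<open>
  For every \<open>h = \<Sum> c\<^sub>g g\<close> with \<open>M = \<Sum> \<bar>c\<^sub>g\<bar>\<close>, the residuals satisfy
  \<open>\<parallel>r\<^sub>N\<parallel> \<le> \<parallel>f - h\<parallel> + 2 M / \<surd>N\<close>. Taking the infimum over \<open>h\<close> turns the right-hand side into
  \<open>K(f, 2 / \<surd>N) \<le> \<parallel>f\<parallel> 2\<^sup>\<theta> N\<^sup>-\<^sup>\<theta>\<^sup>/\<^sup>2\<close>, and \<open>\<theta> / 2 = s\<close>, \<open>2\<^sup>\<theta> \<le> 2\<close>.

  In each algorithm a step starting from \<open>w\<close> removes at least \<open>(w \<bullet> g)\<^sup>2\<close> from \<open>\<parallel>w\<parallel>\<^sup>2\<close>, for every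
  \<open>g\<close> in the dictionary, and some \<open>\<bar>w \<bullet> g\<bar>\<close> is almost as large as \<open>(w \<bullet> h) / M\<close>. For the
  orthogonal algorithm \<open>w = r\<^sub>k\<^sub>-\<^sub>1\<close> is orthogonal to \<open>f\<^sub>k\<^sub>-\<^sub>1\<close>, which gives
  \<open>a\<^sub>k \<le> a\<^sub>k\<^sub>-\<^sub>1 - a\<^sub>k\<^sub>-\<^sub>1\<^sup>2 / (4 M\<^sup>2)\<close> for \<open>a\<^sub>k = \<parallel>r\<^sub>k\<parallel>\<^sup>2 - \<parallel>f - h\<parallel>\<^sup>2\<close>. For the relaxed ones
  \<open>w = f - \<alpha>\<^sub>k f\<^sub>k\<^sub>-\<^sub>1\<close>, and completing the square gives
  \<open>\<parallel>r\<^sub>k\<parallel>\<^sup>2 \<le> (\<alpha>\<^sub>k \<parallel>r\<^sub>k\<^sub>-\<^sub>1\<parallel> + (1 - \<alpha>\<^sub>k) \<parallel>f - h\<parallel>)\<^sup>2 + (1 - \<alpha>\<^sub>k)\<^sup>2 M\<^sup>2\<close>.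
\<close>

section \<open>Expansions, projections and scalar recursions\<close>

lemma L1_expansion_zero: "L1_expansion D 0 (\<lambda>_. 0)"
  by (simp add: L1_expansion_def)

text \<open>A large \<open>w \<bullet> h\<close> forces some dictionary element to correlate well
  with \<open>w\<close>; this is what drives every greedy step.\<close>

lemma inner_le_L1_expansion:
  assumes "L1_expansion D h c" and "\<And>g. g \<in> D \<Longrightarrow> \<bar>w \<bullet> g\<bar> \<le> \<mu>"
  shows "w \<bullet> h \<le> (\<Sum>\<^sub>\<infinity>g\<in>D. \<bar>c g\<bar>) * \<mu>"
proof -
  have c: "((\<lambda>g. \<bar>c g\<bar>) has_sum (\<Sum>\<^sub>\<infinity>g\<in>D. \<bar>c g\<bar>)) D"
    and h: "((\<lambda>g. c g *\<^sub>R g) has_sum h) D"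
    using assms(1) by (auto simp: L1_expansion_def)
  have "((\<lambda>g. w \<bullet> (c g *\<^sub>R g)) has_sum (w \<bullet> h)) D"
    using has_sum_bounded_linear[OF bounded_linear_inner_right h] by (simp add: o_def)
  moreover have "((\<lambda>g. \<bar>c g\<bar> * \<mu>) has_sum (\<Sum>\<^sub>\<infinity>g\<in>D. \<bar>c g\<bar>) * \<mu>) D"
    using c by (rule has_sum_cmult_left)
  moreover have "w \<bullet> (c g *\<^sub>R g) \<le> \<bar>c g\<bar> * \<mu>" if "g \<in> D" for g
  proof -
    have "w \<bullet> (c g *\<^sub>R g) \<le> \<bar>c g\<bar> * \<bar>w \<bullet> g\<bar>"
      by (metis abs_ge_self abs_mult inner_scaleR_right)
    also have "\<dots> \<le> \<bar>c g\<bar> * \<mu>"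
      using assms(2)[OF that] by (rule mult_left_mono) simp
    finally show ?thesis .
  qed
  ultimately show ?thesis
    by (rule has_sum_mono)
qed

lemma norm_diff_inner_scaleR_power2:
  assumes "norm g = 1"
  shows "(norm (w - (w \<bullet> g) *\<^sub>R g))\<^sup>2 = (norm w)\<^sup>2 - (w \<bullet> g)\<^sup>2"
proof -
  have "g \<bullet> g = 1"
    using assms by (simp add: dot_square_norm)
  then show ?thesis
    unfolding power2_norm_eq_inner
    by (simp add: inner_diff_left inner_diff_right inner_commute power2_eq_square algebra_simps)
qed

lemma orthogonal_projection_minimal:
  assumes "is_orthogonal_projection (span S) f u" and "v \<in> span S"
  shows "norm (f - u) \<le> norm (f - v)"
proof -
  have "u - v \<in> span S"
    using assms by (auto simp: is_orthogonal_projection_def intro: span_diff)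
  then have "orthogonal (f - u) (u - v)"
    using assms(1) by (simp add: is_orthogonal_projection_def)
  from norm_add_Pythagorean[OF this]
  have "(norm (f - v))\<^sup>2 = (norm (f - u))\<^sup>2 + (norm (u - v))\<^sup>2"
    by simp
  then show ?thesis
    by (intro power2_le_imp_le[OF _ norm_ge_zero]) simp
qed

lemma norm_le_of_power2_bound:
  fixes x e M :: real
  assumes "real N * (x\<^sup>2 - e\<^sup>2) \<le> 4 * M\<^sup>2" and "N \<ge> 1" and "e \<ge> 0" and "M \<ge> 0"
  shows "x \<le> e + 2 * M / sqrt (real N)"
proof (rule power2_le_imp_le)
  have "x\<^sup>2 \<le> e\<^sup>2 + 4 * M\<^sup>2 / real N"
    using assms(1,2) by (simp add: field_simps)
  also have "\<dots> \<le> e\<^sup>2 + (2 * M / sqrt (real N))\<^sup>2 + 2 * e * (2 * M / sqrt (real N))"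
    using assms by (simp add: power_divide power_mult_distrib)
  also have "\<dots> = (e + 2 * M / sqrt (real N))\<^sup>2"
    by (simp add: power2_sum)
  finally show "x\<^sup>2 \<le> (e + 2 * M / sqrt (real N))\<^sup>2" .
  show "0 \<le> e + 2 * M / sqrt (real N)"
    using assms by simp
qed

text \<open>Discrete analogue of the differential inequality a' \<le> -a^2/A, which gives a(N) \<le>
  A/N. The quadratic drop is asked for at positive terms because \<open>a k\<close> will be a
  difference of squares that may turn negative.\<close>

lemma quadratic_decrease_bound:
  fixes a :: "nat \<Rightarrow> real"
  assumes "A \<ge> 0" and dec: "\<And>k. a (Suc k) \<le> a k"
    and quad: "\<And>k. a k > 0 \<Longrightarrow> (a k)\<^sup>2 \<le> A * (a k - a (Suc k))"
  shows "real N * a N \<le> A"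
proof (induction N)
  case 0
  then show ?case using \<open>A \<ge> 0\<close> by simp
next
  case (Suc k)
  show ?case
  proof (cases "a (Suc k) > 0")
    case False
    then have "real (Suc k) * a (Suc k) \<le> 0"
      by (intro mult_nonneg_nonpos) auto
    then show ?thesis using \<open>A \<ge> 0\<close> by linarith
  next
    case True
    define x y where "x = a k" and "y = a (Suc k)"
    have xy: "0 < y" "0 < x" "x\<^sup>2 \<le> A * (x - y)" "real k * x \<le> A"
      using True dec[of k] quad[of k] Suc.IH by (auto simp: x_def y_def)
    have "A > 0"
      using xy \<open>A \<ge> 0\<close> by (metis less_eq_real_def mult_zero_left not_le zero_less_power)
    \<comment> \<open>Since the next term is positive, the quadratic drop forces
      \<open>x \<le> A\<close>. Then \<open>A - x\<close> is nonnegative and the induction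
      hypothesis can be multiplied by it.\<close>
    have "x * x < A * x"
      using xy(3) mult_pos_pos[OF \<open>A > 0\<close> \<open>0 < y\<close>]
      unfolding power2_eq_square right_diff_distrib by linarith
    then have "x \<le> A"
      using xy by simp
    have "A * (real (Suc k) * y) = real (Suc k) * (A * y)"
      by simp
    also have "\<dots> \<le> real (Suc k) * (A * x - x\<^sup>2)"
      using xy by (intro mult_left_mono) (auto simp: algebra_simps)
    also have "\<dots> = (real k * x) * (A - x) + x * (A - x)"
      by (simp add: power2_eq_square algebra_simps)
    also have "\<dots> \<le> A * (A - x) + x * (A - x)"
      using xy \<open>x \<le> A\<close> by (intro add_right_mono mult_right_mono) auto
    also have "\<dots> = A * A - x * x"
      by (simp add: algebra_simps)
    also have "\<dots> \<le> A * A"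
      by simp
    finally show ?thesis
      using \<open>A > 0\<close> by (simp add: y_def)
  qed
qed

section \<open>The orthogonal greedy algorithm\<close>

lemma OGA_error:
  assumes D: "dictionary D" and run: "OGA_run D f F" and h: "L1_expansion D h c" and "N \<ge> 1"
  shows "norm (f - F N) \<le> norm (f - h) + 2 * (\<Sum>\<^sub>\<infinity>g\<in>D. \<bar>c g\<bar>) / sqrt (real N)"
proof -
  define M where "M = (\<Sum>\<^sub>\<infinity>g\<in>D. \<bar>c g\<bar>)"
  define a where "a k = (norm (f - F k))\<^sup>2 - (norm (f - h))\<^sup>2" for k
  obtain g where F0: "F 0 = 0" and gD: "\<And>k. g (Suc k) \<in> D"
    and gmax: "\<And>k h. h \<in> D \<Longrightarrow> \<bar>(f - F k) \<bullet> h\<bar> \<le> \<bar>(f - F k) \<bullet> g (Suc k)\<bar>"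
    and proj_Suc: "\<And>k. is_orthogonal_projection (span (g ` {1..Suc k})) f (F (Suc k))"
    using run unfolding OGA_run_def by (metis One_nat_def Suc_le_mono diff_Suc_1 le0)
  have "M \<ge> 0"
    unfolding M_def by (rule infsum_nonneg) simp
  \<comment> \<open>At \<open>k = 0\<close> the span is trivial and \<open>F 0 = 0\<close> is the
    projection onto it.\<close>
  have proj: "is_orthogonal_projection (span (g ` {1..k})) f (F k)" for k
    using proj_Suc F0
    by (cases k) (auto simp: is_orthogonal_projection_def orthogonal_def)
  have step: "((f - F k) \<bullet> g (Suc k))\<^sup>2 \<le> a k - a (Suc k)" for k
  proof -
    let ?b = "(f - F k) \<bullet> g (Suc k)"
    have "F k \<in> span (g ` {1..k})"
      using proj by (simp add: is_orthogonal_projection_def)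
    moreover have "span (g ` {1..k}) \<subseteq> span (g ` {1..Suc k})"
      by (intro span_mono image_mono) auto
    moreover have "g (Suc k) \<in> span (g ` {1..Suc k})"
      by (intro span_base imageI) simp
    ultimately have "F k + ?b *\<^sub>R g (Suc k) \<in> span (g ` {1..Suc k})"
      by (intro span_add span_scale) auto
    from orthogonal_projection_minimal[OF proj this]
    have "norm (f - F (Suc k)) \<le> norm (f - F k - ?b *\<^sub>R g (Suc k))"
      by (simp add: algebra_simps)
    then have "(norm (f - F (Suc k)))\<^sup>2 \<le> (norm (f - F k - ?b *\<^sub>R g (Suc k)))\<^sup>2"
      by (intro power_mono) auto
    also have "\<dots> = (norm (f - F k))\<^sup>2 - ?b\<^sup>2"
      using D gD by (intro norm_diff_inner_scaleR_power2) (auto simp: dictionary_def)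
    finally show ?thesis
      by (simp add: a_def)
  qed
  have "real N * a N \<le> 4 * M\<^sup>2"
  proof (rule quadratic_decrease_bound)
    fix k
    show "a (Suc k) \<le> a k"
      using step[of k] zero_le_power2[of "(f - F k) \<bullet> g (Suc k)"] by linarith
    assume pos: "a k > 0"
    let ?r = "f - F k" and ?b = "\<bar>(f - F k) \<bullet> g (Suc k)\<bar>"
    have "?r \<bullet> F k = 0"
      using proj[of k] by (auto simp: is_orthogonal_projection_def orthogonal_def)
    then have "(norm ?r)\<^sup>2 = ?r \<bullet> (f - h) + ?r \<bullet> h"
      by (simp add: power2_norm_eq_inner inner_diff_right)
    also have "\<dots> \<le> norm ?r * norm (f - h) + M * ?b"
      using inner_le_L1_expansion[OF h gmax, of k] norm_cauchy_schwarz[of ?r "f - h"]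
      by (simp add: M_def)
    \<comment> \<open>The product of norms is at most half the sum of their squares; half of the
      squared residual is absorbed on the left, whence the factor 2.\<close>
    finally have "a k \<le> 2 * M * ?b"
      using sum_squares_bound[of "norm ?r" "norm (f - h)"] by (simp add: a_def)
    then have "(a k)\<^sup>2 \<le> (2 * M * ?b)\<^sup>2"
      using pos by (intro power_mono) auto
    also have "\<dots> = 4 * M\<^sup>2 * ((f - F k) \<bullet> g (Suc k))\<^sup>2"
      by (simp add: power_mult_distrib)
    also have "\<dots> \<le> 4 * M\<^sup>2 * (a k - a (Suc k))"
      using step by (intro mult_left_mono) auto
    finally show "(a k)\<^sup>2 \<le> 4 * M\<^sup>2 * (a k - a (Suc k))" .
  qed simp
  then show ?thesis
    unfolding M_def[symmetric]
    using \<open>M \<ge> 0\<close> \<open>N \<ge> 1\<close> by (intro norm_le_of_power2_bound) (auto simp: a_def)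
qed

section \<open>The relaxed greedy algorithms\<close>

lemma RGA_run_step:
  assumes D: "dictionary D" and run: "RGA_run \<alpha> D f F" and h: "L1_expansion D h c"
    and \<alpha>: "0 \<le> \<alpha> (Suc k)" "\<alpha> (Suc k) \<le> 1"
  shows "(norm (f - F (Suc k)))\<^sup>2 \<le>
    (\<alpha> (Suc k) * norm (f - F k) + (1 - \<alpha> (Suc k)) * norm (f - h))\<^sup>2
    + ((1 - \<alpha> (Suc k)) * (\<Sum>\<^sub>\<infinity>g\<in>D. \<bar>c g\<bar>))\<^sup>2"
proof -
  define M where "M = (\<Sum>\<^sub>\<infinity>g\<in>D. \<bar>c g\<bar>)"
  define A B where "A = \<alpha> (Suc k)" and "B = 1 - \<alpha> (Suc k)"
  define w where "w = f - A *\<^sub>R F k"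
  \<comment> \<open>\<open>q\<close> is the square root of the decrease achieved by the step, hence
    it dominates every correlation of \<open>w\<close> with the dictionary.\<close>
  define q where "q = sqrt ((norm w)\<^sup>2 - (norm (f - F (Suc k)))\<^sup>2)"
  obtain \<beta> g where gD: "\<And>k. g (Suc k) \<in> D"
    and min: "\<And>k b h. h \<in> D \<Longrightarrow> norm (f - \<alpha> (Suc k) *\<^sub>R F k - \<beta> (Suc k) *\<^sub>R g (Suc k))
                    \<le> norm (f - \<alpha> (Suc k) *\<^sub>R F k - b *\<^sub>R h)"
    and F: "\<And>k. F (Suc k) = \<alpha> (Suc k) *\<^sub>R F k + \<beta> (Suc k) *\<^sub>R g (Suc k)"
    using run unfolding RGA_run_def by (metis One_nat_def Suc_le_mono diff_Suc_1 le0)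
  have min': "norm (f - F (Suc k)) \<le> norm (w - b *\<^sub>R u)" if "u \<in> D" for b u
    using min[OF that, of k b] by (simp add: w_def A_def F diff_diff_eq)
  have gain: "(w \<bullet> u)\<^sup>2 \<le> (norm w)\<^sup>2 - (norm (f - F (Suc k)))\<^sup>2" if "u \<in> D" for u
  proof -
    have "(norm (f - F (Suc k)))\<^sup>2 \<le> (norm (w - (w \<bullet> u) *\<^sub>R u))\<^sup>2"
      using min'[OF that] by (intro power_mono) auto
    also have "\<dots> = (norm w)\<^sup>2 - (w \<bullet> u)\<^sup>2"
      using D that by (intro norm_diff_inner_scaleR_power2) (auto simp: dictionary_def)
    finally show ?thesis by simp
  qed
  have "norm (f - F (Suc k)) \<le> norm w"
    using min'[OF gD, of 0] by simp
  then have "(norm (f - F (Suc k)))\<^sup>2 \<le> (norm w)\<^sup>2"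
    by (intro power_mono) auto
  then have q2: "q\<^sup>2 = (norm w)\<^sup>2 - (norm (f - F (Suc k)))\<^sup>2"
    by (simp add: q_def)
  have "w \<bullet> h \<le> M * q"
    unfolding M_def
  proof (rule inner_le_L1_expansion[OF h])
    fix u assume "u \<in> D"
    then show "\<bar>w \<bullet> u\<bar> \<le> q"
      unfolding q_def by (intro real_le_rsqrt) (simp add: gain)
  qed
  then have "B * (w \<bullet> h) \<le> B * (M * q)"
    using \<alpha> by (intro mult_left_mono) (auto simp: B_def)
  moreover have "0 \<le> (q - B * M)\<^sup>2"
    by simp
  ultimately have "(norm (f - F (Suc k)))\<^sup>2 \<le> (norm w)\<^sup>2 - 2 * B * (w \<bullet> h) + (B * M)\<^sup>2"
    unfolding power2_diff q2 by (simp add: algebra_simps)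
  also have "(norm w)\<^sup>2 - 2 * B * (w \<bullet> h) = (norm (w - B *\<^sub>R h))\<^sup>2 - (norm (B *\<^sub>R h))\<^sup>2"
    unfolding power2_norm_eq_inner
    by (simp add: inner_diff_left inner_diff_right inner_commute algebra_simps)
  \<comment> \<open>Splitting \<open>f\<close> with the weights \<open>A\<close> and
    \<open>B\<close>, which sum to 1, exposes a convex combination of the old residual and the
    target error.\<close>
  also have "w - B *\<^sub>R h = A *\<^sub>R (f - F k) + B *\<^sub>R (f - h)"
    by (simp add: w_def A_def B_def algebra_simps)
  also have "(norm \<dots>)\<^sup>2 - (norm (B *\<^sub>R h))\<^sup>2 \<le> (norm (A *\<^sub>R (f - F k) + B *\<^sub>R (f - h)))\<^sup>2"
    by simp
  also have "\<dots> \<le> (A * norm (f - F k) + B * norm (f - h))\<^sup>2"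
    using \<alpha> norm_triangle_ineq[of "A *\<^sub>R (f - F k)" "B *\<^sub>R (f - h)"]
    by (intro power_mono) (auto simp: A_def B_def)
  finally show ?thesis
    by (simp add: A_def B_def M_def)
qed

lemma RGA_relax1_error:
  assumes D: "dictionary D" and run: "RGA_run relax1 D f F" and h: "L1_expansion D h c"
    and "N \<ge> 1"
  shows "norm (f - F N) \<le> norm (f - h) + 2 * (\<Sum>\<^sub>\<infinity>g\<in>D. \<bar>c g\<bar>) / sqrt (real N)"
proof -
  define M where "M = (\<Sum>\<^sub>\<infinity>g\<in>D. \<bar>c g\<bar>)"
  define e where "e = norm (f - h)"
  have nonneg: "M \<ge> 0" "e \<ge> 0"
    by (auto simp: M_def e_def intro: infsum_nonneg)
  \<comment> \<open>Multiplying by \<open>k\<close> clears the weights: x_k = k * norm (f - F k)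
    satisfies x_{k+1}^2 \<le> (x_k + e)^2 + M^2. So \<open>e\<close> accumulates linearly, but
    \<open>M\<close> only through its squares.\<close>
  have "real k * norm (f - F k) \<le> real k * e + M * sqrt (real k)" for k
  proof (induction k)
    case 0
    then show ?case by simp
  next
    case (Suc k)
    have "relax1 (Suc k) = real k / real (Suc k)" "1 - relax1 (Suc k) = 1 / real (Suc k)"
      by (auto simp: relax1_def field_simps)
    with RGA_run_step[OF D run h, of k]
    have "(norm (f - F (Suc k)))\<^sup>2
      \<le> (real k / real (Suc k) * norm (f - F k) + 1 / real (Suc k) * e)\<^sup>2 + (1 / real (Suc k) * M)\<^sup>2"
      by (simp add: e_def M_def)
    also have "\<dots> = ((real k * norm (f - F k) + e)\<^sup>2 + M\<^sup>2) / (real (Suc k))\<^sup>2"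
      by (simp add: power_divide add_divide_distrib flip: add_divide_distrib)
    finally have "(real (Suc k) * norm (f - F (Suc k)))\<^sup>2 \<le> (real k * norm (f - F k) + e)\<^sup>2 + M\<^sup>2"
      by (simp add: pos_le_divide_eq power_mult_distrib mult.commute del: of_nat_Suc)
    also have "\<dots> \<le> (real (Suc k) * e + M * sqrt (real k))\<^sup>2 + M\<^sup>2"
      using Suc.IH nonneg by (intro add_right_mono power_mono) (auto simp: algebra_simps)
    also have "\<dots> = (real (Suc k) * e)\<^sup>2 + 2 * (real (Suc k) * e) * (M * sqrt (real k))
        + (M * sqrt (real (Suc k)))\<^sup>2"
      by (simp add: power2_sum power_mult_distrib algebra_simps del: of_nat_Suc)
        (simp add: algebra_simps)
    also have "\<dots> \<le> (real (Suc k) * e)\<^sup>2 + 2 * (real (Suc k) * e) * (M * sqrt (real (Suc k)))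
        + (M * sqrt (real (Suc k)))\<^sup>2"
      using nonneg by (intro add_left_mono add_right_mono mult_left_mono) auto
    also have "\<dots> = (real (Suc k) * e + M * sqrt (real (Suc k)))\<^sup>2"
      by (simp add: power2_sum)
    finally show ?case
      by (rule power2_le_imp_le) (use nonneg in auto)
  qed
  then have "real N * norm (f - F N) \<le> real N * (e + M / sqrt (real N))"
    using real_div_sqrt[of "real N"] by (simp add: distrib_left) (metis mult.commute times_divide_eq_left)
  then have "norm (f - F N) \<le> e + M / sqrt (real N)"
    using \<open>N \<ge> 1\<close> by simp
  \<comment> \<open>The constant is weakened from 1 to 2 to match the other two algorithms.\<close>
  also have "\<dots> \<le> e + 2 * M / sqrt (real N)"
    using nonneg by (simp add: divide_right_mono)
  finally show ?thesis
    by (simp add: e_def M_def)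
qed

lemma RGA_relax2_error:
  assumes D: "dictionary D" and run: "RGA_run relax2 D f F" and h: "L1_expansion D h c"
    and "N \<ge> 1"
  shows "norm (f - F N) \<le> norm (f - h) + 2 * (\<Sum>\<^sub>\<infinity>g\<in>D. \<bar>c g\<bar>) / sqrt (real N)"
proof -
  define M where "M = (\<Sum>\<^sub>\<infinity>g\<in>D. \<bar>c g\<bar>)"
  define e where "e = norm (f - h)"
  define a where "a k = (norm (f - F k))\<^sup>2 - e\<^sup>2" for k
  have nonneg: "M \<ge> 0" "e \<ge> 0"
    by (auto simp: M_def e_def intro: infsum_nonneg)
  have step: "a (Suc k) \<le> relax2 (Suc k) * a k + ((1 - relax2 (Suc k)) * M)\<^sup>2" for k
  proof -
    let ?A = "relax2 (Suc k)" and ?x = "norm (f - F k)"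
    have A: "0 \<le> ?A" "?A \<le> 1"
      by (auto simp: relax2_def field_simps)
    \<comment> \<open>This quantity is exactly the gap in the convexity inequality for the
      square.\<close>
    have "0 \<le> ?A * (1 - ?A) * (?x - e)\<^sup>2"
      using A by simp
    then have "(?A * ?x + (1 - ?A) * e)\<^sup>2 \<le> ?A * ?x\<^sup>2 + (1 - ?A) * e\<^sup>2"
      by (simp add: power2_eq_square algebra_simps)
    with RGA_run_step[OF D run h A] show ?thesis
      by (simp add: a_def e_def M_def algebra_simps)
  qed
  \<comment> \<open>The induction starts at index 1, where \<open>relax2 1 = 0\<close> erases the
    initial error and leaves \<open>M\<close> squared.\<close>
  have "real (Suc k) * a (Suc k) \<le> 4 * M\<^sup>2" for k
  proof (induction k)
    case 0
    then show ?case
      using step[of 0] by (simp add: relax2_def) (smt (verit) zero_le_power2)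
  next
    case (Suc k)
    define n where "n = real k"
    have n: "n \<ge> 0" and IH: "a (Suc k) \<le> 4 * M\<^sup>2 / (n + 1)"
      using Suc.IH by (auto simp: n_def field_simps)
    have \<alpha>: "relax2 (Suc (Suc k)) = n / (n + 2)" "1 - relax2 (Suc (Suc k)) = 2 / (n + 2)"
      by (auto simp: relax2_def n_def field_simps)
    have "(n + 2) * a (Suc (Suc k)) \<le> (n + 2) * (n / (n + 2) * a (Suc k) + (2 / (n + 2) * M)\<^sup>2)"
      using step[of "Suc k"] n unfolding \<alpha>(2) unfolding \<alpha>(1) by (intro mult_left_mono) auto
    also have "\<dots> = n * a (Suc k) + 4 * M\<^sup>2 / (n + 2)"
    proof -
      have "m * (n / m * x + (2 / m * M)\<^sup>2) = n * x + 4 * M\<^sup>2 / m" if "m > 0" for m x :: real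
        using that by (simp add: power2_eq_square distrib_left)
      then show ?thesis
        using n by simp
    qed
    also have "\<dots> \<le> n * (4 * M\<^sup>2 / (n + 1)) + 4 * M\<^sup>2 / (n + 1)"
      using n IH by (intro add_mono mult_left_mono divide_left_mono) auto
    also have "\<dots> = (n + 1) * (4 * M\<^sup>2 / (n + 1))"
      by (simp only: distrib_right mult_1)
    also have "\<dots> = 4 * M\<^sup>2"
      using n by simp
    finally show ?case
      by (simp add: n_def algebra_simps)
  qed
  from this[of "N - 1"] have "real N * a N \<le> 4 * M\<^sup>2"
    using \<open>N \<ge> 1\<close> by simp
  then show ?thesis
    unfolding M_def[symmetric] e_def[symmetric]
    using nonneg \<open>N \<ge> 1\<close> by (intro norm_le_of_power2_bound) (auto simp: a_def)
qed

text \<open>Two infima are nested here, over \<open>h\<close> and over the expansions of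
  \<open>h\<close>. A lower bound uniform in both passes through each, the inner one after division
  by \<open>t\<close>.\<close>

lemma le_K_functional:
  assumes "t > 0"
    and "\<And>h c. L1_expansion D h c \<Longrightarrow> x \<le> norm (f - h) + t * (\<Sum>\<^sub>\<infinity>g\<in>D. \<bar>c g\<bar>)"
  shows "x \<le> K_functional D f t"
  unfolding K_functional_def
proof (rule cINF_greatest)
  show "L1_space D \<noteq> {}"
    using L1_expansion_zero by (auto simp: L1_space_def)
next
  fix h assume "h \<in> L1_space D"
  then have "(x - norm (f - h)) / t \<le> L1_norm D h"
    unfolding L1_norm_def L1_space_def
    using assms by (intro cInf_greatest) (auto simp: field_simps)
  then show "x \<le> norm (f - h) + t * L1_norm D h"
    using \<open>t > 0\<close> by (simp add: field_simps)
qed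

section \<open>Passage to the interpolation norm\<close>

lemma B_norm_bound:
  assumes "f \<in> B_space D p" and "1 < p" and "p < 2" and "N \<ge> 1" and "x \<ge> 0"
    and bound: "\<And>h c. L1_expansion D h c \<Longrightarrow>
      x \<le> norm (f - h) + 2 * (\<Sum>\<^sub>\<infinity>g\<in>D. \<bar>c g\<bar>) / sqrt (real N)"
  shows "x \<le> 2 * B_norm D p f * real N powr (- (1 / p - 1 / 2))"
proof -
  define \<theta> where "\<theta> = 2 / p - 1"
  define t where "t = 2 / sqrt (real N)"
  define y where "y = real N powr (- (1 / p - 1 / 2))"
  have pos: "t > 0" "y > 0"
    using \<open>N \<ge> 1\<close> by (auto simp: t_def y_def)
  have "t powr \<theta> = 2 powr \<theta> * y"
    using \<open>N \<ge> 1\<close> \<open>1 < p\<close>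
    by (simp add: t_def y_def \<theta>_def powr_divide powr_half_sqrt[symmetric] powr_powr powr_minus_divide
        field_simps)
  moreover have "2 powr \<theta> \<le> 2 powr 1"
    using assms by (intro powr_mono) (auto simp: \<theta>_def field_simps)
  ultimately have t: "t powr \<theta> \<le> 2 * y"
    using pos by simp
  have "x \<le> K_functional D f t"
    using bound pos by (intro le_K_functional) (auto simp: t_def)
  have "x / (2 * y) \<le> interp_norm D \<theta> f"
    unfolding interp_norm_def
  proof (rule cInf_greatest)
    show "{C. \<forall>t>0. K_functional D f t \<le> C * t powr \<theta>} \<noteq> {}"
      using assms(1) by (auto simp: B_space_def interp_space_def \<theta>_def)
  next
    fix C assume "C \<in> {C. \<forall>t>0. K_functional D f t \<le> C * t powr \<theta>}"
    with \<open>x \<le> K_functional D f t\<close> have x: "x \<le> C * t powr \<theta>"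
      using pos by fastforce
    \<comment> \<open>Replacing \<open>t powr \<theta>\<close> by the larger \<open>2 * y\<close>
      requires a nonnegative \<open>C\<close>, which follows from \<open>x \<ge> 0\<close>.\<close>
    with \<open>x \<ge> 0\<close> have "0 \<le> C * t powr \<theta>"
      by linarith
    then have "C \<ge> 0"
      using pos by (simp add: zero_le_mult_iff)
    with x t have "x \<le> C * (2 * y)"
      by (meson mult_left_mono order_trans)
    then show "x / (2 * y) \<le> C"
      using pos by (simp add: field_simps)
  qed
  then show ?thesis
    using pos by (simp add: B_norm_def \<theta>_def y_def field_simps)
qed

section \<open>Comparison with best N-term approximation\<close>

lemma best_error_le:
  assumes "S \<subseteq> D" and "finite S" and "card S \<le> N" and "u \<in> span S"
  shows "best_error D N f \<le> norm (f - u)"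
  unfolding best_error_def
proof (rule cINF_lower)
  show "bdd_below ((\<lambda>h. norm (f - h)) ` sparse_combinations D N)"
    by (rule bdd_belowI[of _ 0]) auto
  show "u \<in> sparse_combinations D N"
    using assms by (auto simp: sparse_combinations_def)
qed

lemma best_error_le_OGA:
  assumes run: "OGA_run D f F" and "N \<ge> 1"
  shows "best_error D N f \<le> norm (f - F N)"
proof -
  obtain g where "\<And>k. k \<ge> 1 \<Longrightarrow> g k \<in> D"
    and "\<And>k. k \<ge> 1 \<Longrightarrow> is_orthogonal_projection (span (g ` {1..k})) f (F k)"
    using run unfolding OGA_run_def by metis
  with \<open>N \<ge> 1\<close> show ?thesis
    \<comment> \<open>Selected elements may repeat, so their number is only bounded by
      \<open>N\<close>.\<close>
    using card_image_le[of "{1..N}" g]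
    by (intro best_error_le[of "g ` {1..N}"]) (auto simp: is_orthogonal_projection_def)
qed

lemma best_error_le_RGA:
  assumes run: "RGA_run \<alpha> D f F"
  shows "best_error D N f \<le> norm (f - F N)"
proof -
  obtain \<beta> g where F0: "F 0 = 0" and gD: "\<And>k. k \<ge> 1 \<Longrightarrow> g k \<in> D"
    and F: "\<And>k. k \<ge> 1 \<Longrightarrow> F k = \<alpha> k *\<^sub>R F (k - 1) + \<beta> k *\<^sub>R g k"
    using run unfolding RGA_run_def by metis
  have "F N \<in> span (g ` {1..N})"
  proof (induction N)
    case 0
    then show ?case by (simp add: F0)
  next
    case (Suc k)
    have "span (g ` {1..k}) \<subseteq> span (g ` {1..Suc k})"
      by (intro span_mono image_mono) auto
    moreover have "g (Suc k) \<in> span (g ` {1..Suc k})"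
      by (intro span_base imageI) simp
    ultimately have "\<alpha> (Suc k) *\<^sub>R F k + \<beta> (Suc k) *\<^sub>R g (Suc k) \<in> span (g ` {1..Suc k})"
      using Suc.IH by (intro span_add span_scale) auto
    then show ?case
      by (simp add: F)
  qed
  then show ?thesis
    using gD card_image_le[of "{1..N}" g] by (intro best_error_le[of "g ` {1..N}"]) auto
qed

text \<open>An existential constant could depend on the type \<open>'a\<close>, that is, on the
  Hilbert space; the bound \<open>C \<le> 2\<close> makes it absolute.\<close>

theorem corollary2p6:
  shows "\<exists>C::real. C \<le> 2 \<and>
    (\<forall>run \<in> {OGA_run, RGA_run relax1, RGA_run relax2}.
     \<forall>(D :: 'a::{real_inner, complete_space} set) (p::real) (s::real).
       dictionary D \<longrightarrow> 1 < p \<longrightarrow> p < 2 \<longrightarrow> s = 1 / p - 1 / 2 \<longrightarrow>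
         (\<forall>f\<in>B_space D p. \<forall>F. run D f F \<longrightarrow>
            (\<forall>N\<ge>1. norm (f - F N) \<le> C * B_norm D p f * real N powr (- s)))
       \<and> (\<forall>G. (\<forall>f. run D f (G f)) \<longrightarrow>
            B_space D p \<subseteq> G_class G s \<and> G_class G s \<subseteq> A_class D s))"
proof (rule exI[of _ 2], intro conjI ballI allI impI order_refl)
  fix run :: "'a set \<Rightarrow> 'a \<Rightarrow> (nat \<Rightarrow> 'a) \<Rightarrow> bool" and D :: "'a set" and p s :: real
  assume run: "run \<in> {OGA_run, RGA_run relax1, RGA_run relax2}"
    and D: "dictionary D" and p: "1 < p" "p < 2" and s: "s = 1 / p - 1 / 2"
  have rate: "norm (f - F N) \<le> 2 * B_norm D p f * real N powr (- s)"
    if "f \<in> B_space D p" "run D f F" "N \<ge> 1" for f F N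
    unfolding s
  proof (rule B_norm_bound[OF that(1) p that(3) norm_ge_zero])
    fix h c assume "L1_expansion D h c"
    then show "norm (f - F N) \<le> norm (f - h) + 2 * (\<Sum>\<^sub>\<infinity>g\<in>D. \<bar>c g\<bar>) / sqrt (real N)"
      using run that D OGA_error RGA_relax1_error RGA_relax2_error by blast
  qed
  then show "norm (f - F N) \<le> 2 * B_norm D p f * real N powr (- s)"
    if "f \<in> B_space D p" "run D f F" "1 \<le> N" for f F N
    using that by blast
  fix G assume G: "\<forall>f. run D f (G f)"
  show "B_space D p \<subseteq> G_class G s"
    unfolding G_class_def using rate G by blast
  have "best_error D N f \<le> norm (f - G f N)" if "N \<ge> 1" for f N
    using run G that best_error_le_OGA best_error_le_RGA by blast
  then show "G_class G s \<subseteq> A_class D s"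
    unfolding G_class_def A_class_def by (blast intro: order_trans)
qed

end
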